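(* Let $k=k(n)$ be a sequence of non-negative integers with $k=n^{o(1)}$ as $n\to\infty$. Then, as $n\to\infty$, $$m(n,k)=n^{(1+o(1))\binom{n}{k}},$$ where $m(n,k)$ denotes the number of maximal families in $\mathcal{P}(n)$ of VC dimension $k$.
   Context: $\mathcal{P}(n)$ is the power set of $[n]=\{1,\dots,n\}$. A family $\mathcal{F}\subseteq\mathcal{P}(n)$ shatters $S\subseteq[n]$ if for every $A\subseteq S$ there is $B\in\mathcal{F}$ with $B\cap S=A$. The VC dimension $\mathrm{VC}(\mathcal{F})$ is the maximum size of a set shattered by $\mathcal{F}$. Write $\binom{n}{\le k}=\sum_{i=0}^k\binom{n}{i}$. By the Sauer–Shelah lemma $|\mathcal{F}|\le\binom{n}{\le \mathrm{VC}(\mathcal{F})}$; a family $\mathcal{F}$ is called maximal if $|\mathcal{F}|=\binom{n}{\le \mathrm{VC}(\mathcal{F})}$. $m(n,k)$ is the number of maximal families $\mathcal{F}\subseteq\mathcal{P}(n)$ with $\mathrm{VC}(\mathcal{F})=k$. *)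

theory Defs
  imports Complex_Main "HOL-Library.Landau_Symbols"
begin

definition shatters :: "nat set set \<Rightarrow> nat set \<Rightarrow> bool" where
  "shatters F S \<longleftrightarrow> (\<forall>A. A \<subseteq> S \<longrightarrow> (\<exists>B\<in>F. B \<inter> S = A))"

(* Every nonempty F shatters the empty set, so the maximum is over a finite nonempty set.
   For F = {} the value is unspecified; this is harmless below, since the empty family has
   cardinality 0 < binom_le n d for all d and hence is never maximal. *)
definition VC :: "nat \<Rightarrow> nat set set \<Rightarrow> nat" where
  "VC n F = Max {card S |S. S \<subseteq> {1..n} \<and> shatters F S}"

definition binom_le :: "nat \<Rightarrow> nat \<Rightarrow> nat" where
  "binom_le n k = (\<Sum>i\<le>k. n choose i)"

(* Maximal in the sense of equality in the Sauer-Shelah bound, not inclusion-maximal. *)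
definition maximal_family :: "nat \<Rightarrow> nat set set \<Rightarrow> bool" where
  "maximal_family n F \<longleftrightarrow> F \<subseteq> Pow {1..n} \<and> card F = binom_le n (VC n F)"

definition m :: "nat \<Rightarrow> nat \<Rightarrow> nat" where
  "m n k = card {F. maximal_family n F \<and> VC n F = k}"

end

theory Submission
  imports Defs "HOL-Library.Tree" "HOL-Library.FuncSet" "HOL-Real_Asymp.Real_Asymp"
begin

text \<open>
  Upper bound: call a family extremal if it has as many members as it shatters sets. Pajor's
  inequality shows that maximal families are extremal and that extremality passes to subcubes.
  Hence an extremal family is connected in the hypercube graph, since a subcube cannot contain
  just two antipodal members at distance at least two. A graph of maximum degree \<open>n\<close> has at most
  \<open>2 (4 n) ^ N\<close> connected vertex sets of size \<open>N + 1\<close> through a given vertex, and there are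
  \<open>2 ^ n\<close> vertices.

  Lower bound: start from all sets of size at most \<open>k\<close>, fix \<open>T\<close> of size about \<open>n / (k ln n)\<close>, and
  replace each \<open>k\<close>-set \<open>A\<close> disjoint from \<open>T\<close> by \<open>A \<union> {f A}\<close> with an arbitrary \<open>f A \<in> T\<close>. The
  replaced pairs form an induced matching between layers \<open>k\<close> and \<open>k + 1\<close>, so no
  \<open>(k + 1)\<close>-set becomes shattered.
\<close>

section \<open>Extremal families\<close>

text \<open>Equality case of \<open>pajor\<close>. The shattered sets are taken without a ground
  set; each of them lies inside a member of the family.\<close>

definition extremal :: "nat set set \<Rightarrow> bool" where
  "extremal F \<longleftrightarrow> card {S. shatters F S} = card F"

lemma shatters_mono: "shatters F S \<Longrightarrow> F \<subseteq> G \<Longrightarrow> shatters G S"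
  unfolding shatters_def by (meson subsetD)

lemma shatters_subset_member: "shatters F S \<Longrightarrow> \<exists>B\<in>F. S \<subseteq> B"
  unfolding shatters_def by (metis inf.cobounded1 order_refl)

lemma finite_shattered:
  assumes "finite F" "\<And>A. A \<in> F \<Longrightarrow> finite A"
  shows "finite {S. shatters F S}"
proof (rule finite_subset)
  show "{S. shatters F S} \<subseteq> \<Union>(Pow ` F)" using shatters_subset_member by blast
  show "finite (\<Union>(Pow ` F))" using assms by simp
qed

lemma shatters_empty_iff: "shatters F {} \<longleftrightarrow> F \<noteq> {}"
  by (auto simp: shatters_def)

lemma shatters_singletonI:
  "A \<in> F \<Longrightarrow> B \<in> F \<Longrightarrow> x \<in> A \<Longrightarrow> x \<notin> B \<Longrightarrow> shatters F {x}"
  unfolding shatters_def by (auto simp: subset_singleton_iff)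

text \<open>Sets shattered by either half avoid \<open>x\<close> and are shattered by
  \<open>F\<close>. A set \<open>S\<close> shattered by both halves is counted twice on the left,
  and its second count is paid for by \<open>insert x S\<close>, which \<open>F\<close> also
  shatters: one half realises the traces without \<open>x\<close>, the other those with
  \<open>x\<close>.\<close>

lemma card_shattered_split:
  assumes "finite F" "\<And>A. A \<in> F \<Longrightarrow> finite A"
  shows "card {S. shatters {A \<in> F. x \<notin> A} S} + card {S. shatters {A \<in> F. x \<in> A} S}
    \<le> card {S. shatters F S}"
proof -
  define F0 F1 where "F0 = {A \<in> F. x \<notin> A}" and "F1 = {A \<in> F. x \<in> A}"
  define S0 S1 where "S0 = {S. shatters F0 S}" and "S1 = {S. shatters F1 S}"
  have fin: "finite S0" "finite S1" "finite {S. shatters F S}"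
    unfolding S0_def S1_def using assms
    by (auto intro!: finite_shattered simp: F0_def F1_def)
  \<comment> \<open>A set shattered by \<open>F0\<close> lies in a member that avoids
    \<open>x\<close>; for \<open>F1\<close>, the empty trace comes from a member that contains
    \<open>x\<close>.\<close>
  have x0: "x \<notin> S" if "S \<in> S0" for S
    using that shatters_subset_member unfolding S0_def F0_def by blast
  have x1: "x \<notin> S" if "S \<in> S1" for S
  proof -
    from that obtain B where "B \<in> F1" "B \<inter> S = {}"
      unfolding S1_def shatters_def by blast
    then show ?thesis by (auto simp: F1_def)
  qed
  have ins: "shatters F (insert x S)" if S: "S \<in> S0" "S \<in> S1" for S
    unfolding shatters_def
  proof (intro allI impI)
    fix A assume A: "A \<subseteq> insert x S"
    show "\<exists>B\<in>F. B \<inter> insert x S = A"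
    proof (cases "x \<in> A")
      case True
      from A have "A - {x} \<subseteq> S" by auto
      with S obtain B where "B \<in> F1" "B \<inter> S = A - {x}"
        unfolding S1_def shatters_def by blast
      with True show ?thesis by (intro bexI[of _ B]) (auto simp: F1_def)
    next
      case False
      with A have "A \<subseteq> S" by auto
      with S obtain B where "B \<in> F0" "B \<inter> S = A"
        unfolding S0_def shatters_def by blast
      with False show ?thesis by (intro bexI[of _ B]) (auto simp: F0_def)
    qed
  qed
  have "card S0 + card S1 = card (S0 \<union> S1) + card (S0 \<inter> S1)"
    by (rule card_Un_Int[OF fin(1,2)])
  also have "card (S0 \<inter> S1) = card (insert x ` (S0 \<inter> S1))"
    by (rule card_image[symmetric], rule inj_onI) (metis IntE insert_ident x0)
  also have "card (S0 \<union> S1) + card (insert x ` (S0 \<inter> S1))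
      = card ((S0 \<union> S1) \<union> insert x ` (S0 \<inter> S1))"
    by (rule card_Un_disjoint[symmetric]) (use fin x0 x1 in auto)
  also have "\<dots> \<le> card {S. shatters F S}"
  proof (rule card_mono[OF fin(3)])
    have "shatters F S" if "S \<in> S0 \<union> S1" for S
      using that shatters_mono[of F0 S F] shatters_mono[of F1 S F]
      by (auto simp: S0_def S1_def F0_def F1_def)
    with ins show "(S0 \<union> S1) \<union> insert x ` (S0 \<inter> S1) \<subseteq> {S. shatters F S}" by auto
  qed
  finally show ?thesis by (simp add: S0_def S1_def F0_def F1_def)
qed

lemma card_split_member:
  assumes "finite F"
  shows "card {A \<in> F. x \<notin> A} + card {A \<in> F. x \<in> A} = card F"
proof -
  have "F = {A \<in> F. x \<notin> A} \<union> {A \<in> F. x \<in> A}" by blast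
  then show ?thesis
    using card_Un_disjoint[of "{A \<in> F. x \<notin> A}" "{A \<in> F. x \<in> A}"] assms by force
qed

text \<open>Splitting at an element that separates two members makes both halves strictly smaller,
  and \<open>card_shattered_split\<close> adds up the two induction hypotheses. A family with one
  member shatters the empty set.\<close>

lemma pajor:
  assumes "finite F" "\<And>A. A \<in> F \<Longrightarrow> finite A"
  shows "card F \<le> card {S. shatters F S}"
  using assms
proof (induction "card F" arbitrary: F rule: less_induct)
  case less
  show ?case
  proof (cases "card F \<le> 1")
    case True
    show ?thesis
    proof (cases "F = {}")
      case False
      then have "{} \<in> {S. shatters F S}" by (simp add: shatters_empty_iff)
      then have "card {S. shatters F S} > 0"
        using finite_shattered[OF less.prems] card_gt_0_iff by blast
      with True show ?thesis by linarith
    qed simp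
  next
    case False
    then obtain A B where AB: "A \<in> F" "B \<in> F" "A \<noteq> B"
      using card_le_Suc0_iff_eq[OF less.prems(1)] by auto
    then obtain x where x: "x \<in> A \<and> x \<notin> B \<or> x \<in> B \<and> x \<notin> A" by blast
    have "{A \<in> F. x \<notin> A} \<subset> F" "{A \<in> F. x \<in> A} \<subset> F" using AB x by blast+
    then have "card {A \<in> F. x \<notin> A} < card F" "card {A \<in> F. x \<in> A} < card F"
      using less.prems(1) psubset_card_mono by blast+
    then have "card {A \<in> F. x \<notin> A} \<le> card {S. shatters {A \<in> F. x \<notin> A} S}"
      "card {A \<in> F. x \<in> A} \<le> card {S. shatters {A \<in> F. x \<in> A} S}"
      using less.prems by (auto intro!: less.hyps)
    then show ?thesis
      using card_shattered_split[OF less.prems, of x] card_split_member[OF less.prems(1), of x]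
      by linarith
  qed
qed

text \<open>Pajor's inequality holds in each half and the shattered counts of the halves add up to
  at most that of \<open>F\<close>, so equality for \<open>F\<close> forces equality in both
  halves.\<close>

lemma extremal_split:
  assumes "finite F" "\<And>A. A \<in> F \<Longrightarrow> finite A" "extremal F"
  shows "extremal {A \<in> F. x \<notin> A}" "extremal {A \<in> F. x \<in> A}"
proof -
  have "card {A \<in> F. x \<notin> A} \<le> card {S. shatters {A \<in> F. x \<notin> A} S}"
    "card {A \<in> F. x \<in> A} \<le> card {S. shatters {A \<in> F. x \<in> A} S}"
    using assms(1,2) by (auto intro!: pajor)
  then show "extremal {A \<in> F. x \<notin> A}" "extremal {A \<in> F. x \<in> A}"
    using card_shattered_split[OF assms(1,2), of x] card_split_member[OF assms(1), of x] assms(3)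
    unfolding extremal_def by linarith+
qed

text \<open>Fixing the coordinates in \<open>Y\<close> one at a time, each as in \<open>A\<close>,
  is an iteration of \<open>extremal_split\<close>.\<close>

lemma extremal_subcube:
  assumes "finite Y" "finite F" "\<And>A. A \<in> F \<Longrightarrow> finite A" "extremal F"
  shows "extremal {X \<in> F. X \<inter> Y = A \<inter> Y}"
  using assms(1)
proof (induction Y)
  case empty
  then show ?case using assms by simp
next
  case (insert y Y)
  let ?G = "{X \<in> F. X \<inter> Y = A \<inter> Y}"
  have *: "finite ?G" "\<And>A. A \<in> ?G \<Longrightarrow> finite A" using assms by auto
  have "{X \<in> F. X \<inter> insert y Y = A \<inter> insert y Y}
      = (if y \<in> A then {X \<in> ?G. y \<in> X} else {X \<in> ?G. y \<notin> X})"
    using insert.hyps by auto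
  then show ?case using extremal_split[OF * insert.IH] by auto
qed

section \<open>Connectivity of extremal families in the hypercube graph\<close>

definition toggle :: "'a \<Rightarrow> 'a set \<Rightarrow> 'a set" where
  "toggle i A = sym_diff A {i}"

text \<open>Induction on the Hamming distance of \<open>A\<close> and \<open>B\<close>. The members
  in the subcube spanned by \<open>A\<close> and \<open>B\<close> form an extremal family that
  shatters the empty set and every singleton of \<open>D\<close>, so there are at least
  \<open>card D + 1\<close> of them. If \<open>A\<close> and \<open>B\<close> are the only ones,
  they are adjacent; otherwise a third member is strictly closer to \<open>A\<close>, and its
  differences from \<open>A\<close> lie in \<open>D\<close>.\<close>

lemma extremal_neighbour:
  assumes F: "finite F" "\<And>A. A \<in> F \<Longrightarrow> finite A" "extremal F"
    and "A \<in> F" "B \<in> F" "A \<noteq> B"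
  shows "\<exists>i \<in> sym_diff A B. toggle i A \<in> F"
  using assms(4-)
proof (induction "card (sym_diff A B)" arbitrary: B rule: less_induct)
  case less
  define D where "D = sym_diff A B"
  \<comment> \<open>Only the coordinates in \<open>D\<close> stay free. Intersecting with the union
    of \<open>F\<close> keeps the set of fixed coordinates finite.\<close>
  define G where "G = {X \<in> F. X \<inter> (\<Union>F - D) = A \<inter> (\<Union>F - D)}"
  have finD: "finite D" using F less.prems by (auto simp: D_def)
  have G: "finite G" "\<And>X. X \<in> G \<Longrightarrow> finite X" using F by (auto simp: G_def)
  have AB: "A \<in> G" "B \<in> G" using less.prems by (auto simp: G_def D_def)
  have "extremal G"
    unfolding G_def by (rule extremal_subcube) (use F in auto)
  then have "card G = card {S. shatters G S}" by (simp add: extremal_def)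
  also have "\<dots> \<ge> card (insert {} ((\<lambda>i. {i}) ` D))"
  proof (rule card_mono[OF finite_shattered[OF G]])
    have "shatters G {i}" if "i \<in> D" for i
      using that AB shatters_singletonI[of A G B i] shatters_singletonI[of B G A i]
      by (auto simp: D_def)
    then show "insert {} ((\<lambda>i. {i}) ` D) \<subseteq> {S. shatters G S}"
      using AB by (auto simp: shatters_empty_iff)
  qed
  finally have cG: "Suc (card D) \<le> card G"
    using finD by (simp add: card_image image_iff)
  show ?case
  proof (cases "G = {A, B}")
    case True
    with cG less.prems have "card D \<le> 1" by simp
    moreover have "D \<noteq> {}" using less.prems by (auto simp: D_def)
    ultimately obtain i where i: "D = {i}"
      by (metis card_1_singletonE card_eq_0_iff finD le_Suc_eq le_zero_eq One_nat_def)
    then have "toggle i A = B" by (auto simp: D_def toggle_def)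
    with i less.prems show ?thesis by (auto simp: D_def)
  next
    case False
    with AB obtain C where C: "C \<in> G" "C \<noteq> A" "C \<noteq> B" by blast
    have CF: "C \<in> F" using C by (simp add: G_def)
    have sub: "sym_diff A C \<subseteq> D"
      using C CF \<open>A \<in> F\<close> by (auto simp: G_def)
    moreover have "sym_diff A C \<noteq> D"
    proof
      assume eq: "sym_diff A C = D"
      have "C = B"
        using eq by (auto simp: D_def)
      with C show False by simp
    qed
    ultimately have "card (sym_diff A C) < card D"
      using finD by (intro psubset_card_mono) auto
    from less.hyps[OF this[unfolded D_def] \<open>A \<in> F\<close> CF C(2)[symmetric]] sub
    show ?thesis by (auto simp: D_def)
  qed
qed

text \<open>Connectivity is stated through cuts: every proper nonempty part has an edge leaving it.
  From a member of \<open>W\<close>, repeated toggles inside \<open>F\<close> lead ever closer to a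
  fixed \<open>B\<close> outside \<open>W\<close>, so some toggle leaves \<open>W\<close>.\<close>

lemma extremal_connected:
  assumes F: "finite F" "\<And>A. A \<in> F \<Longrightarrow> finite A" "extremal F"
    and W: "W \<subset> F" "W \<noteq> {}"
  shows "\<exists>A\<in>W. \<exists>i\<in>\<Union>F. toggle i A \<in> F - W"
proof -
  have "\<exists>A\<in>W. \<exists>i\<in>\<Union>F. toggle i A \<in> F - W" if "A \<in> W" "B \<in> F - W" for A B
    using that
  proof (induction "card (sym_diff A B)" arbitrary: A rule: less_induct)
    case less
    have AF: "A \<in> F" "A \<noteq> B" "B \<in> F" using W less.prems by auto
    obtain i where i: "i \<in> sym_diff A B" "toggle i A \<in> F"
      using extremal_neighbour[OF F AF(1,3,2)] by blast
    have iU: "i \<in> \<Union>F" using i AF by auto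
    show ?case
    proof (cases "toggle i A \<in> W")
      case True
      have "sym_diff (toggle i A) B = sym_diff A B - {i}"
        using i by (auto simp: toggle_def)
      then have "card (sym_diff (toggle i A) B) < card (sym_diff A B)"
        using i F(2)[OF AF(1)] F(2)[OF AF(3)] by (simp only:) (rule psubset_card_mono; blast)
      then show ?thesis using less True by blast
    qed (use less i iU in blast)
  qed
  with W show ?thesis by blast
qed

section \<open>Counting connected vertex sets\<close>

text \<open>A rooted tree of moves in left-child right-sibling form: the left subtree continues from
  the vertex just reached, the right subtree from the current vertex.\<close>

fun visited :: "('l \<Rightarrow> 'v \<Rightarrow> 'v) \<Rightarrow> 'l tree \<Rightarrow> 'v \<Rightarrow> 'v set" where
  "visited f Leaf v = {v}"
| "visited f (Node l a r) v = visited f l (f a v) \<union> visited f r v"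

text \<open>Every visited vertex is contributed by some leaf of the tree. Replacing a leaf at
  \<open>w\<close> by \<open>Node Leaf a Leaf\<close> keeps \<open>w\<close> and adds
  \<open>f a w\<close>.\<close>

lemma visited_extend:
  assumes "w \<in> visited f t v"
  shows "\<exists>t'. visited f t' v = insert (f a w) (visited f t v) \<and> size t' = Suc (size t)
    \<and> set_tree t' = insert a (set_tree t)"
  using assms
proof (induction t arbitrary: v)
  case Leaf
  then show ?case by (intro exI[of _ "Node Leaf a Leaf"]) auto
next
  case (Node l b r)
  then consider "w \<in> visited f l (f b v)" | "w \<in> visited f r v" by auto
  then show ?case
  proof cases
    case 1
    from Node.IH(1)[OF this] obtain l' where
      "visited f l' (f b v) = insert (f a w) (visited f l (f b v))" "size l' = Suc (size l)"
      "set_tree l' = insert a (set_tree l)" by blast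
    then show ?thesis by (intro exI[of _ "Node l' b r"]) auto
  next
    case 2
    from Node.IH(2)[OF this] obtain r' where
      "visited f r' v = insert (f a w) (visited f r v)" "size r' = Suc (size r)"
      "set_tree r' = insert a (set_tree r)" by blast
    then show ?thesis by (intro exI[of _ "Node l b r'"]) auto
  qed
qed

text \<open>The visited set grows from \<open>v\<close> by one new vertex at a time, along an edge
  supplied by the cut condition. Each new vertex costs one tree node, hence the size is one less
  than \<open>card F\<close>.\<close>

lemma connected_set_visited:
  assumes fin: "finite F" and v: "v \<in> F"
    and conn: "\<And>W. W \<subset> F \<Longrightarrow> W \<noteq> {} \<Longrightarrow> \<exists>w\<in>W. \<exists>i\<in>X. f i w \<in> F - W"
  shows "\<exists>t. visited f t v = F \<and> Suc (size t) = card F \<and> set_tree t \<subseteq> X"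
proof -
  have "\<exists>t. visited f t v \<subseteq> F \<and> card (visited f t v) = Suc s \<and> size t = s \<and> set_tree t \<subseteq> X"
    if "s < card F" for s
    using that
  proof (induction s)
    case 0
    then show ?case using v by (intro exI[of _ Leaf]) auto
  next
    case (Suc s)
    then obtain t where t: "visited f t v \<subseteq> F" "card (visited f t v) = Suc s" "size t = s"
      "set_tree t \<subseteq> X" by auto
    have "visited f t v \<noteq> F" "visited f t v \<noteq> {}" using t(2) Suc.prems by auto
    then obtain w i where w: "w \<in> visited f t v" "i \<in> X" "f i w \<in> F - visited f t v"
      using conn[of "visited f t v"] t(1) by blast
    from visited_extend[OF w(1), of i] obtain t' where
      "visited f t' v = insert (f i w) (visited f t v)" "size t' = Suc (size t)"
      "set_tree t' = insert i (set_tree t)" by blast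
    moreover have "finite (visited f t v)" using t(2) card_ge_0_finite by force
    ultimately show ?case using t w by (intro exI[of _ t']) auto
  qed
  moreover have "card F > 0" using fin v card_gt_0_iff by blast
  ultimately obtain t where t: "visited f t v \<subseteq> F" "card (visited f t v) = Suc (card F - 1)"
    "size t = card F - 1" "set_tree t \<subseteq> X" by (metis diff_less zero_less_one)
  then have "visited f t v = F" using \<open>card F > 0\<close> fin by (intro card_subset_eq) auto
  with t \<open>card F > 0\<close> show ?thesis by auto
qed

text \<open>The weights satisfy \<open>W (d + 1) = 1 + W d ^ 2 / 4\<close>, which keeps them below 2.\<close>

lemma tree_weight_bound:
  assumes "finite X" "X \<noteq> {}"
  shows "finite {t. set_tree t \<subseteq> X \<and> height t \<le> d} \<and>
    (\<Sum>t | set_tree t \<subseteq> X \<and> height t \<le> d. (1 / (4 * real (card X))) ^ size t) \<le> 2"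
proof (induction d)
  case 0
  have "{t. set_tree t \<subseteq> X \<and> height t \<le> 0} = {Leaf}"
    by auto
  then show ?case by simp
next
  case (Suc d)
  let ?T = "\<lambda>d. {t. set_tree t \<subseteq> X \<and> height t \<le> d}"
  \<comment> \<open>The factor \<open>card X\<close> in the denominator cancels the choice of the
    root label, and the 4 is what makes 2 a fixed point of the recursion.\<close>
  let ?x = "1 / (4 * real (card X))"
  let ?g = "\<lambda>(l, a, r). Node l a r"
  \<comment> \<open>A nonempty tree is a root label with two subtrees of smaller height, so the
    weighted sum factors into a product.\<close>
  have eq: "?T (Suc d) = insert Leaf (?g ` (?T d \<times> X \<times> ?T d))" (is "?L = ?R")
  proof (rule set_eqI)
    fix t show "t \<in> ?L \<longleftrightarrow> t \<in> ?R"
      by (cases t) (auto simp: image_iff)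
  qed
  have inj: "inj_on ?g (?T d \<times> X \<times> ?T d)" by (auto simp: inj_on_def)
  have fin: "finite (?T d)" using Suc by blast
  have fin2: "finite (?g ` (?T d \<times> X \<times> ?T d))"
    by (intro finite_imageI finite_cartesian_product fin assms(1))
  define w where "w t = ?x ^ size t" for t :: "'a tree"
  define s where "s = (\<Sum>t\<in>?T d. w t)"
  have s: "0 \<le> s" "s \<le> 2" using Suc by (auto simp: s_def w_def intro!: sum_nonneg)
  have "(\<Sum>t\<in>?T (Suc d). w t) = 1 + (\<Sum>t\<in>?g ` (?T d \<times> X \<times> ?T d). w t)"
    unfolding eq by (subst sum.insert[OF fin2]) (auto simp: w_def)
  also have "(\<Sum>t\<in>?g ` (?T d \<times> X \<times> ?T d). w t)
      = (\<Sum>(l, a, r)\<in>?T d \<times> X \<times> ?T d. w l * (?x * w r))"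
    by (subst sum.reindex[OF inj]) (auto intro!: sum.cong simp: power_add w_def)
  also have "\<dots> = (\<Sum>l\<in>?T d. \<Sum>a\<in>X. \<Sum>r\<in>?T d. w l * (?x * w r))"
    unfolding sum.cartesian_product by (rule refl)
  also have "\<dots> = (\<Sum>l\<in>?T d. \<Sum>a\<in>X. w l * (?x * s))"
    unfolding s_def by (simp only: sum_distrib_left)
  also have "\<dots> = s * (real (card X) * (?x * s))"
    unfolding s_def sum_distrib_right by simp
  also have "\<dots> = s * s / 4" using assms by (simp add: field_simps)
  also have "1 + s * s / 4 \<le> 2" using mult_mono[OF s(2) s(2)] s by simp
  finally show ?case using fin2 eq by (simp add: w_def)
qed

text \<open>Trees of size \<open>N\<close> have height at most \<open>N\<close> and all carry the
  same weight \<open>?x ^ N\<close>, so the bound 2 on the total weight bounds their number.\<close>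

lemma card_trees_le:
  assumes "finite X" "X \<noteq> {}"
  shows "finite {t. set_tree t \<subseteq> X \<and> size t = N}"
    and "real (card {t. set_tree t \<subseteq> X \<and> size t = N}) \<le> 2 * (4 * real (card X)) ^ N"
proof -
  let ?A = "{t. set_tree t \<subseteq> X \<and> size t = N}"
  let ?B = "{t. set_tree t \<subseteq> X \<and> height t \<le> N}"
  let ?x = "1 / (4 * real (card X))"
  have B: "finite ?B" "(\<Sum>t\<in>?B. ?x ^ size t) \<le> 2" using tree_weight_bound[OF assms] by auto
  have sub: "?A \<subseteq> ?B" using height_le_size_tree by auto
  show "finite ?A" using finite_subset[OF sub B(1)] .
  have "real (card ?A) * ?x ^ N = (\<Sum>t\<in>?A. ?x ^ size t)" by simp
  also have "\<dots> \<le> (\<Sum>t\<in>?B. ?x ^ size t)" by (rule sum_mono2[OF B(1) sub]) auto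
  also note B(2)
  finally have "real (card ?A) * ?x ^ N \<le> 2" .
  moreover have "card X > 0" using assms card_gt_0_iff by blast
  ultimately show "real (card ?A) \<le> 2 * (4 * real (card X)) ^ N"
    by (simp add: power_divide field_simps)
qed

section \<open>The upper bound\<close>

lemma card_subsets_le:
  assumes "finite X"
  shows "finite {S. S \<subseteq> X \<and> card S \<le> k}" "card {S. S \<subseteq> X \<and> card S \<le> k} = binom_le (card X) k"
proof -
  show "finite {S. S \<subseteq> X \<and> card S \<le> k}" using assms by simp
  have "{S. S \<subseteq> X \<and> card S \<le> k} = (\<Union>i\<le>k. {S. S \<subseteq> X \<and> card S = i})" by auto
  also have "card \<dots> = (\<Sum>i\<le>k. card {S. S \<subseteq> X \<and> card S = i})"
    using assms by (intro card_UN_disjoint) auto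
  finally show "card {S. S \<subseteq> X \<and> card S \<le> k} = binom_le (card X) k"
    using n_subsets[OF assms] by (simp add: binom_le_def)
qed

lemma finite_VC_set: "finite {card S |S. S \<subseteq> {1..n} \<and> shatters F S}"
proof -
  have "{card S |S. S \<subseteq> {1..n} \<and> shatters F S} \<subseteq> card ` Pow {1..n}" by auto
  then show ?thesis by (rule finite_subset) simp
qed

text \<open>Shattered sets lie in \<open>{1..n}\<close> and have size at most the VC dimension, so
  there are at most \<open>binom_le n (VC n F)\<close> of them, which is \<open>card F\<close>.
  Pajor's inequality gives the other direction.\<close>

lemma maximal_imp_extremal:
  assumes "maximal_family n F"
  shows "extremal F" "F \<noteq> {}"
proof -
  from assms have F: "F \<subseteq> Pow {1..n}" "card F = binom_le n (VC n F)"
    by (auto simp: maximal_family_def)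
  have fin: "finite F" using finite_subset[OF F(1)] by simp
  have finA: "\<And>A. A \<in> F \<Longrightarrow> finite A" using F(1) finite_subset by blast
  \<comment> \<open>The summand for \<open>i = 0\<close> is already 1.\<close>
  have "binom_le n (VC n F) > 0"
    by (auto simp: binom_le_def sum.atMost_shift)
  then show "F \<noteq> {}" using F by auto
  have "{S. shatters F S} \<subseteq> {S. S \<subseteq> {1..n} \<and> card S \<le> VC n F}"
  proof safe
    fix S assume S: "shatters F S"
    have sub: "S \<subseteq> {1..n}" using shatters_subset_member[OF S] F(1) by blast
    then show "card S \<le> VC n F"
      unfolding VC_def by (intro Max_ge finite_VC_set) (use S in blast)
    show "x \<in> {1..n}" if "x \<in> S" for x using sub that by blast
  qed
  then have "card {S. shatters F S} \<le> binom_le n (VC n F)"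
    using card_mono[OF card_subsets_le(1)[of "{1..n}"], of "{S. shatters F S}" "VC n F"]
      card_subsets_le(2)[of "{1..n}"] by simp
  then show "extremal F" using pajor[OF fin finA] F(2) by (simp add: extremal_def)
qed

text \<open>A maximal family is recovered from one of its members and a tree of
  \<open>?N - 1\<close> coordinate toggles, so it suffices to count such pairs.\<close>

lemma m_upper:
  assumes "n > 0"
  shows "real (m n k) \<le> 2 ^ n * (2 * (4 * real n) ^ binom_le n k)"
proof -
  let ?N = "binom_le n k"
  let ?T = "{t :: nat tree. set_tree t \<subseteq> {1..n} \<and> size t = ?N - 1}"
  let ?h = "\<lambda>(v, t). visited toggle t v"
  have T: "finite ?T" "real (card ?T) \<le> 2 * (4 * real n) ^ (?N - 1)"
    using card_trees_le[of "{1..n}" "?N - 1"] assms by simp_all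
  have "{F. maximal_family n F \<and> VC n F = k} \<subseteq> ?h ` (Pow {1..n} \<times> ?T)"
  proof safe
    fix F assume F: "maximal_family n F" "k = VC n F"
    have sub: "F \<subseteq> Pow {1..n}" and card: "card F = ?N"
      using F by (auto simp: maximal_family_def)
    have fin: "finite F" using finite_subset[OF sub] by simp
    have finA: "\<And>A. A \<in> F \<Longrightarrow> finite A" using sub finite_subset by blast
    obtain v where v: "v \<in> F" using maximal_imp_extremal[OF F(1)] by blast
    have "\<exists>w\<in>W. \<exists>i\<in>{1..n}. toggle i w \<in> F - W" if "W \<subset> F" "W \<noteq> {}" for W
      using extremal_connected[OF fin finA maximal_imp_extremal(1)[OF F(1)] that] sub by blast
    from connected_set_visited[OF fin v this] obtain t where
      "visited toggle t v = F" "Suc (size t) = card F" "set_tree t \<subseteq> {1..n}" by blast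
    then show "F \<in> ?h ` (Pow {1..n} \<times> {t. set_tree t \<subseteq> {1..n} \<and> size t = binom_le n (VC n F) - 1})"
      using v sub card F(2) by (intro image_eqI[of _ _ "(v, t)"]) auto
  qed
  then have "m n k \<le> card (?h ` (Pow {1..n} \<times> ?T))"
    unfolding m_def by (rule card_mono[rotated]) (use T in auto)
  also have "\<dots> \<le> card (Pow {1..n} \<times> ?T)" by (rule card_image_le) (use T in auto)
  also have "\<dots> = 2 ^ n * card ?T" by (simp add: card_cartesian_product card_Pow)
  finally have "real (m n k) \<le> real (2 ^ n * card ?T)" by (rule of_nat_mono)
  also have "\<dots> = 2 ^ n * real (card ?T)" by simp
  also have "\<dots> \<le> 2 ^ n * (2 * (4 * real n) ^ (?N - 1))" using T by simp
  also have "(4 * real n) ^ (?N - 1) \<le> (4 * real n) ^ ?N"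
    using assms by (intro power_increasing) auto
  finally show ?thesis by simp
qed

section \<open>The lower bound\<close>

definition shifted_family :: "nat \<Rightarrow> nat \<Rightarrow> nat set \<Rightarrow> (nat set \<Rightarrow> nat) \<Rightarrow> nat set set" where
  "shifted_family n k T f =
     ({A. A \<subseteq> {1..n} \<and> card A \<le> k} - {A. A \<subseteq> {1..n} - T \<and> card A = k})
     \<union> (\<lambda>A. insert (f A) A) ` {A. A \<subseteq> {1..n} - T \<and> card A = k}"

context
  fixes n k :: nat and T :: "nat set" and f :: "nat set \<Rightarrow> nat"
  assumes T: "T \<subseteq> {1..n}"
    and f: "\<And>A. A \<subseteq> {1..n} - T \<Longrightarrow> card A = k \<Longrightarrow> f A \<in> T"
begin

lemma shifted_family_subset: "shifted_family n k T f \<subseteq> Pow {1..n}"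
  using T f by (auto simp: shifted_family_def)

text \<open>The replacement is injective, since removing \<open>T\<close> gives back the original
  set, and the new sets have size \<open>k + 1\<close>, so they cannot coincide with the sets
  kept.\<close>

lemma card_shifted_family: "card (shifted_family n k T f) = binom_le n k"
proof -
  define K where "K = {A. A \<subseteq> {1..n} - T \<and> card A = k}"
  define P where "P = {A. A \<subseteq> {1..n} \<and> card A \<le> k}"
  have P: "finite P" "card P = binom_le n k" using card_subsets_le[of "{1..n}" k]
    by (auto simp: P_def)
  have KP: "K \<subseteq> P" by (auto simp: K_def P_def)
  have f': "f A \<in> T" "T \<inter> A = {}" "finite A" "card A = k" if "A \<in> K" for A
    using f[of A] that finite_subset[of A "{1..n}"] by (auto simp: K_def)
  have inj: "inj_on (\<lambda>A. insert (f A) A) K"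
  proof (rule inj_onI)
    fix A B assume *: "A \<in> K" "B \<in> K" "insert (f A) A = insert (f B) B"
    have "A = insert (f A) A - T" "B = insert (f B) B - T" using f' *(1,2) by blast+
    with *(3) show "A = B" by metis
  qed
  have "card (insert (f A) A) = Suc k" if "A \<in> K" for A
    using f'[OF that] by (subst card_insert_disjoint) auto
  then have "(P - K) \<inter> (\<lambda>A. insert (f A) A) ` K = {}"
    by (auto simp: P_def)
  then have "card (shifted_family n k T f) = card (P - K) + card K"
    unfolding shifted_family_def P_def[symmetric] K_def[symmetric]
    using P(1) KP finite_subset[OF KP]
    by (subst card_Un_disjoint) (auto simp: card_image[OF inj])
  also have "\<dots> = card P"
    using P(1) KP by (metis card_Diff_subset card_mono finite_subset le_add_diff_inverse2)
  finally show ?thesis using P by simp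
qed

lemma VC_shifted_family:
  assumes "T \<noteq> {}" "1 \<le> k" "k \<le> n"
  shows "VC n (shifted_family n k T f) = k"
  unfolding VC_def
proof (rule Max_eqI[OF finite_VC_set])
  define F where "F = shifted_family n k T f"
  fix y assume "y \<in> {card S |S. S \<subseteq> {1..n} \<and> shatters (shifted_family n k T f) S}"
  then obtain S where S: "S \<subseteq> {1..n}" "shatters F S" "y = card S" by (auto simp: F_def)
  have finS: "finite S" using S finite_subset by blast
  show "y \<le> k"
  proof (rule ccontr)
    assume "\<not> y \<le> k"
    then have cS: "card S \<ge> Suc k" using S by simp
    obtain B where B: "B \<in> F" "S \<subseteq> B" using shatters_subset_member[OF S(2)] by blast
    have finB: "finite B"
      using B shifted_family_subset finite_subset[of B "{1..n}"] by (auto simp: F_def)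
    have "card B \<ge> Suc k" using cS card_mono[OF finB B(2)] by linarith
    then obtain A where A: "A \<subseteq> {1..n} - T" "card A = k" "B = insert (f A) A"
      using B by (auto simp: F_def shifted_family_def)
    have "f A \<in> T" using f A by blast
    have finA: "finite A" using A finB by simp
    have "card B \<le> Suc k" using A finA by (simp add: card_insert_if)
    \<comment> \<open>No member has more than \<open>k + 1\<close> elements, so a larger shattered
      set would have to be a replaced set itself.\<close>
    then have SB: "S = B" using cS B finB by (intro card_seteq) auto
    \<comment> \<open>The trace \<open>A\<close>, which misses only \<open>f A\<close>, is the one
      that cannot be realised: \<open>A\<close> itself was removed, and a replaced set containing
      \<open>A\<close> can only be \<open>insert (f A) A\<close>.\<close>
    obtain C where C: "C \<in> F" "C \<inter> S = A"
      using S(2) A SB unfolding shatters_def by (metis subset_insertI)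
    have AC: "A \<subseteq> C" "f A \<notin> C" using C SB A \<open>f A \<in> T\<close> by auto
    have finC: "finite C"
      using C shifted_family_subset finite_subset[of C "{1..n}"] by (auto simp: F_def)
    from C(1) consider "card C \<le> k" "\<not> (C \<subseteq> {1..n} - T \<and> card C = k)"
      | A' where "A' \<subseteq> {1..n} - T" "card A' = k" "C = insert (f A') A'"
      by (auto simp: F_def shifted_family_def)
    then show False
    proof cases
      case 1
      then have "A = C" using AC A finC by (intro card_seteq) auto
      with 1 A show False by simp
    next
      case 2
      have "f A' \<in> T" using f 2 by blast
      then have "A \<subseteq> A'" using AC A 2 by blast
      then have "A = A'" using A 2 finC by (intro card_seteq) auto
      with AC 2 show False by simp
    qed
  qed
next
  define F where "F = shifted_family n k T f"
  \<comment> \<open>A \<open>k\<close>-set meeting \<open>T\<close> is shattered: it is never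
    replaced itself, and its proper subsets have fewer than \<open>k\<close> elements and are all
    kept. The bound \<open>1 \<le> k\<close> leaves room for \<open>x\<close>.\<close>
  obtain x where x: "x \<in> T" using assms by blast
  have "k - 1 \<le> card ({1..n} - {x})" using x T assms by (simp add: subset_iff)
  then obtain R where R: "R \<subseteq> {1..n} - {x}" "card R = k - 1" "finite R"
    using obtain_subset_with_card_n by metis
  let ?S = "insert x R"
  have cS: "card ?S = k" using R assms by (subst card_insert_disjoint) auto
  have S: "?S \<subseteq> {1..n}" using R x T by auto
  have "A \<in> F" if "A \<subseteq> ?S" for A
  proof (cases "A = ?S")
    case True
    then show ?thesis using S cS x by (auto simp: F_def shifted_family_def)
  next
    case False
    with that have "card A < k" using cS R by (metis finite_insert psubsetI psubset_card_mono)
    then show ?thesis using that S by (auto simp: F_def shifted_family_def)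
  qed
  then have "shatters F ?S" unfolding shatters_def by (metis inf.absorb1)
  then show "k \<in> {card S |S. S \<subseteq> {1..n} \<and> shatters (shifted_family n k T f) S}"
    using cS S by (auto simp: F_def)
qed

end

text \<open>Each function from the \<open>k\<close>-sets outside \<open>T\<close> to
  \<open>T\<close> gives a maximal family. The function can be read off, because
  \<open>insert (f A) A\<close> is the only member of size \<open>k + 1\<close> whose part outside
  \<open>T\<close> is \<open>A\<close>.\<close>

lemma m_lower:
  assumes "1 \<le> t" "t \<le> n" "1 \<le> k" "k \<le> n"
  shows "t ^ ((n - t) choose k) \<le> m n k"
proof -
  define T where "T = {1..t}"
  define K where "K = {A. A \<subseteq> {1..n} - T \<and> card A = k}"
  let ?Fs = "K \<rightarrow>\<^sub>E T"
  have T: "T \<subseteq> {1..n}" "T \<noteq> {}" "finite T" "card T = t" using assms by (auto simp: T_def)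
  have cK: "finite K" "card K = (n - t) choose k"
    using n_subsets[of "{1..n} - T" k] T by (auto simp: K_def card_Diff_subset)
  have f: "f A \<in> T" if "f \<in> ?Fs" "A \<subseteq> {1..n} - T" "card A = k" for f A
    using that by (auto simp: K_def)
  have inj: "inj_on (shifted_family n k T) ?Fs"
  proof (rule inj_onI)
    fix f g assume fg: "f \<in> ?Fs" "g \<in> ?Fs" "shifted_family n k T f = shifted_family n k T g"
    show "f = g"
    proof (rule PiE_ext[OF fg(1,2)])
      fix A assume A: "A \<in> K"
      have fA: "f A \<in> T" using fg A by auto
      have "finite A" using A finite_subset[of A "{1..n}"] by (auto simp: K_def)
      then have "card (insert (f A) A) = Suc k"
        using A fA by (subst card_insert_disjoint) (auto simp: K_def)
      moreover have "insert (f A) A \<in> shifted_family n k T g"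
        unfolding fg(3)[symmetric] using A by (auto simp: shifted_family_def K_def)
      ultimately obtain B where B: "B \<in> K" "insert (f A) A = insert (g B) B"
        by (auto simp: shifted_family_def K_def)
      have gB: "g B \<in> T" using fg B by auto
      have "A = insert (f A) A - T" "B = insert (g B) B - T"
        using A B(1) fA gB by (auto simp: K_def)
      then have "A = B" using B(2) by metis
      moreover have "f A \<notin> A" using A fA by (auto simp: K_def)
      ultimately show "f A = g A" using B(2) by blast
    qed
  qed
  have "t ^ ((n - t) choose k) = card ?Fs" using cK T by (simp add: card_PiE)
  also have "\<dots> = card (shifted_family n k T ` ?Fs)" by (rule card_image[OF inj, symmetric])
  also have "\<dots> \<le> m n k"
    unfolding m_def
  proof (rule card_mono)
    show "finite {F. maximal_family n F \<and> VC n F = k}"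
      by (rule finite_subset[of _ "Pow (Pow {1..n})"]) (auto simp: maximal_family_def)
    have "maximal_family n (shifted_family n k T f) \<and> VC n (shifted_family n k T f) = k"
      if "f \<in> ?Fs" for f
      using shifted_family_subset[OF T(1) f[OF that]] card_shifted_family[OF T(1) f[OF that]]
        VC_shifted_family[OF T(1) f[OF that] T(2) assms(3,4)]
      by (simp add: maximal_family_def)
    then show "shifted_family n k T ` ?Fs \<subseteq> {F. maximal_family n F \<and> VC n F = k}"
      by blast
  qed
  finally show ?thesis .
qed

section \<open>Asymptotics\<close>

text \<open>For small \<open>k\<close> the last binomial coefficient dominates the sum of all the
  lower ones. The ratio bound is multiplied out, so that the induction divides by nothing and holds
  whatever the sign of the left factor.\<close>

lemma binom_le_bound:
  assumes "k \<le> n"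
  shows "(real n - 2 * real k + 1) * real (binom_le n k)
    \<le> (real n - real k + 1) * real (n choose k)"
  using assms
proof (induction k)
  case 0
  then show ?case by (simp add: binom_le_def)
next
  case (Suc k)
  have IH: "(real n - 2 * real k + 1) * real (binom_le n k)
    \<le> (real n - real k + 1) * real (n choose k)" using Suc by simp
  have eq: "(real k + 1) * real (n choose Suc k) = (real n - real k) * real (n choose k)"
  proof -
    have "Suc k * (n choose Suc k) = (n - k) * (n choose k)"
      by (metis binomial_absorb_comp binomial_absorption mult.commute)
    then have "real (Suc k * (n choose Suc k)) = real ((n - k) * (n choose k))" by simp
    then show ?thesis using Suc.prems by (simp add: of_nat_diff algebra_simps)
  qed
  have le: "real (n choose k) \<le> real (binom_le n k)"
    unfolding binom_le_def of_nat_le_iff by (rule member_le_sum) auto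
  have S: "real (binom_le n (Suc k)) = real (binom_le n k) + real (n choose Suc k)"
    by (simp add: binom_le_def)
  show ?case using IH eq le unfolding S by (simp add: algebra_simps)
qed

lemma binomial_right_mono: "l \<le> n \<Longrightarrow> l choose k \<le> n choose k"
  by (rule lift_Suc_mono_le[of "\<lambda>i. i choose k"]) (cases k; simp)

text \<open>By Pascal's rule, each of the \<open>t\<close> removed points costs at most
  \<open>(n - 1) choose (k - 1)\<close>, which is the fraction \<open>k / n\<close> of
  \<open>n choose k\<close>.\<close>

lemma binomial_diff_bound:
  assumes "1 \<le> k" "t \<le> n"
  shows "real n * real ((n - t) choose k) \<ge> (real n - real t * real k) * real (n choose k)"
proof -
  have step: "n choose k \<le> ((n - t) choose k) + t * ((n - 1) choose (k - 1))"
    using assms(2)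
  proof (induction t)
    case (Suc t)
    have "(n - t) choose k = ((n - Suc t) choose k) + ((n - Suc t) choose (k - 1))"
      using Suc.prems assms(1)
      by (metis Suc_diff_Suc Suc_le_lessD add.commute binomial_Suc_Suc le_add_diff_inverse plus_1_eq_Suc)
    moreover have "(n - Suc t) choose (k - 1) \<le> (n - 1) choose (k - 1)"
      by (rule binomial_right_mono) simp
    ultimately show ?case using Suc by simp
  qed simp
  have abs: "k * (n choose k) = n * ((n - 1) choose (k - 1))"
    using assms(1) by (simp add: times_binomial_minus1_eq)
  have "n * (n choose k) \<le> n * ((n - t) choose k) + t * (n * ((n - 1) choose (k - 1)))"
    using mult_le_mono2[OF step, of n] by (simp add: algebra_simps)
  then have "n * (n choose k) \<le> n * ((n - t) choose k) + t * (k * (n choose k))"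
    by (simp add: abs)
  then have "real (n * (n choose k)) \<le> real (n * ((n - t) choose k) + t * (k * (n choose k)))"
    by (rule of_nat_mono)
  then show ?thesis by (simp add: algebra_simps)
qed

text \<open>This lets the factor \<open>2 ^ n\<close> for the starting vertex be absorbed into the
  error term of the upper bound.\<close>

lemma le_binomial:
  assumes "1 \<le> k" "k < n"
  shows "n \<le> n choose k"
  using assms
proof (induction n arbitrary: k)
  case (Suc n)
  then obtain j where j: "k = Suc j" by (cases k) auto
  show ?case
  proof (cases "k < n")
    case True
    then have "n \<le> n choose k" using Suc by simp
    moreover have "n choose j \<noteq> 0" using True j by simp
    ultimately show ?thesis unfolding j binomial_Suc_Suc by linarith
  next
    case False
    then have "n = Suc j" using Suc.prems j by simp
    then show ?thesis by (simp add: j)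
  qed
qed simp

section \<open>Logarithmic estimates and the limit\<close>

lemma ln_m_upper:
  assumes "1 \<le> k" "real k \<le> sqrt (real n)" "n \<ge> 5" "m n k > 0"
  shows "ln (real (m n k)) / (ln (real n) * real (n choose k))
    \<le> 2 * ln 2 / ln (real n)
      + (real n + 1) / (real n - 2 * sqrt (real n) + 1) * (1 + ln 4 / ln (real n))"
proof -
  define L where "L = ln (real n)"
  define C where "C = real (n choose k)"
  define N where "N = real (binom_le n k)"
  define q where "q = (real n + 1) / (real n - 2 * sqrt (real n) + 1)"
  have L: "L > 0" using assms by (simp add: L_def)
  have s: "2 < sqrt (real n)" using assms by (simp add: real_less_rsqrt)
  \<comment> \<open>The denominator of \<open>q\<close> is a square, hence positive for these
    \<open>n\<close>.\<close>
  have "(sqrt (real n) - 1)\<^sup>2 = real n - 2 * sqrt (real n) + 1"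
    using assms by (simp add: power2_eq_square algebra_simps)
  moreover have "(sqrt (real n) - 1)\<^sup>2 > 0" using s by (intro zero_less_power) linarith
  ultimately have d: "real n - 2 * sqrt (real n) + 1 > 0" by simp
  have "2 * sqrt (real n) < sqrt (real n) * sqrt (real n)"
    using s by (intro mult_strict_right_mono) linarith+
  then have kn: "k < n" using assms s by simp
  have nC: "real n \<le> C" using le_binomial[OF assms(1) kn] by (simp add: C_def)
  have C1: "1 \<le> C" using nC assms by simp
  \<comment> \<open>Trading \<open>k\<close> for its bound \<open>sqrt n\<close> yields a factor
    \<open>q\<close> that depends on \<open>n\<close> alone and tends to 1.\<close>
  have "(real n - 2 * sqrt (real n) + 1) * N \<le> (real n - 2 * real k + 1) * N"
    using assms by (intro mult_right_mono) (auto simp: N_def)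
  also have "\<dots> \<le> (real n - real k + 1) * C"
    using binom_le_bound[of k n] kn by (simp add: N_def C_def)
  also have "\<dots> \<le> (real n + 1) * C" using C1 by (intro mult_right_mono) auto
  finally have N: "N \<le> q * C" using d by (simp add: q_def field_simps)
  have n0: "n > 0" using assms by simp
  have "ln (real (m n k)) \<le> ln (2 ^ n * (2 * (4 * real n) ^ binom_le n k))"
    using m_upper[OF n0, of k] assms n0 by (subst ln_le_cancel_iff) auto
  also have "\<dots> = real n * ln 2 + ln 2 + N * (ln 4 + L)"
    using n0 by (simp add: ln_mult ln_realpow N_def L_def algebra_simps)
  also have "\<dots> \<le> C * ln 2 + C * ln 2 + (q * C) * (ln 4 + L)"
    using nC C1 N L by (intro add_mono mult_right_mono) auto
  finally have "ln (real (m n k)) / (L * C) \<le> (C * ln 2 + C * ln 2 + (q * C) * (ln 4 + L)) / (L * C)"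
    using L C1 by (intro divide_right_mono) auto
  also have "\<dots> = 2 * ln 2 / L + q * (1 + ln 4 / L)"
    using L C1 by (simp add: field_simps)
  finally show ?thesis by (simp add: L_def C_def q_def)
qed

lemma ln_m_lower:
  assumes "1 \<le> k" "k \<le> n" "ln (real n) \<ge> 1" "2 * real k * ln (real n) \<le> real n"
  shows "ln (real (m n k)) / (ln (real n) * real (n choose k))
    \<ge> (1 - 1 / ln (real n)) * (1 - ln (real k) / ln (real n) - ln (2 * ln (real n)) / ln (real n))"
    and "m n k > 0"
proof -
  define L where "L = ln (real n)"
  define C where "C = real (n choose k)"
  \<comment> \<open>This size of \<open>T\<close> balances two losses: \<open>t * k / n\<close> is
    at most \<open>1 / L\<close>, so almost all \<open>k\<close>-sets avoid \<open>T\<close>, while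
    \<open>ln t\<close> falls short of \<open>L\<close> by at most
    \<open>ln k + ln (2 * L)\<close>.\<close>
  define u where "u = real n / (real k * L)"
  define t where "t = nat \<lfloor>u\<rfloor>"
  have L: "L \<ge> 1" using assms by (simp add: L_def)
  have k: "real k \<ge> 1" using assms by simp
  have n: "n \<ge> 1" using assms by simp
  have C: "C > 0" using assms by (simp add: C_def)
  have kL: "real k * L \<ge> 1" using mult_mono[OF k L] by simp
  \<comment> \<open>With \<open>u\<close> at least 2, rounding down leaves \<open>t\<close> positive
    and at least \<open>u / 2\<close>.\<close>
  have u2: "u \<ge> 2" using assms(4) kL by (simp add: u_def L_def field_simps)
  have tu: "real t \<le> u" "u - 1 \<le> real t" using u2 by (simp_all add: t_def)
  have "u \<le> real n" using kL n by (simp add: u_def field_simps)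
  then have tn: "t \<le> n" using tu by linarith
  have t1: "t \<ge> 1" using tu u2 by linarith
  have "t ^ ((n - t) choose k) \<le> m n k" by (rule m_lower) (use t1 tn assms in auto)
  moreover have "t ^ ((n - t) choose k) > 0" using t1 by simp
  ultimately show m0: "m n k > 0" by linarith
  have "real t * real k \<le> u * real k" using tu by (intro mult_right_mono) auto
  also have "\<dots> = real n / L" using k by (simp add: u_def)
  finally have tk: "real t * real k \<le> real n / L" .
  have "(real n - real n / L) * C \<le> (real n - real t * real k) * C"
    using tk C by (intro mult_right_mono) auto
  also have "\<dots> \<le> real n * real ((n - t) choose k)"
    using binomial_diff_bound[OF assms(1) tn] by (simp add: C_def)
  finally have "real n * ((1 - 1 / L) * C) \<le> real n * real ((n - t) choose k)"
    by (simp add: algebra_simps)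
  then have bin: "(1 - 1 / L) * C \<le> real ((n - t) choose k)" using n by simp
  have "u / 2 \<le> real t" using tu u2 by linarith
  then have "ln (u / 2) \<le> ln (real t)" using u2 by (subst ln_le_cancel_iff) auto
  moreover have "ln (u / 2) = L - ln (real k) - ln (2 * L)"
  proof -
    have "u / 2 = real n / (real k * (2 * L))" by (simp add: u_def)
    then have "ln (u / 2) = ln (real n) - (ln (real k) + ln (2 * L))"
      using n k L by (simp only:) (subst ln_div; simp add: ln_mult)
    then show ?thesis by (simp add: L_def)
  qed
  ultimately have lt: "L - ln (real k) - ln (2 * L) \<le> ln (real t)" by simp
  have lt0: "0 \<le> ln (real t)" using t1 by simp
  have "((1 - 1 / L) * C) * (L - ln (real k) - ln (2 * L)) \<le> ((1 - 1 / L) * C) * ln (real t)"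
    using lt L C by (intro mult_left_mono) auto
  also have "\<dots> \<le> real ((n - t) choose k) * ln (real t)"
    using bin lt0 by (intro mult_right_mono)
  also have "\<dots> = ln (real (t ^ ((n - t) choose k)))" using t1 by (simp add: ln_realpow)
  also have "\<dots> \<le> ln (real (m n k))"
    using \<open>t ^ ((n - t) choose k) \<le> m n k\<close> \<open>t ^ ((n - t) choose k) > 0\<close> m0
    by (subst ln_le_cancel_iff) (auto simp flip: of_nat_power)
  finally have "((1 - 1 / L) * C) * (L - ln (real k) - ln (2 * L)) / (L * C)
      \<le> ln (real (m n k)) / (L * C)"
    using L C by (intro divide_right_mono) auto
  moreover have "((1 - 1 / L) * C) * (L - ln (real k) - ln (2 * L)) / (L * C)
      = (1 - 1 / L) * (1 - ln (real k) / L - ln (2 * L) / L)"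
    using L C by (simp add: field_simps)
  ultimately show "ln (real (m n k)) / (ln (real n) * real (n choose k))
    \<ge> (1 - 1 / ln (real n)) * (1 - ln (real k) / ln (real n) - ln (2 * ln (real n)) / ln (real n))"
    by (simp add: L_def C_def)
qed

theorem theorem1p1:
  fixes k :: "nat \<Rightarrow> nat"
  assumes "\<exists>\<delta> :: nat \<Rightarrow> real. \<delta> \<in> o(\<lambda>_. 1) \<and>
             (\<forall>\<^sub>F n in sequentially. real (k n) = real n powr \<delta> n)"
  shows "\<exists>\<epsilon> :: nat \<Rightarrow> real. \<epsilon> \<in> o(\<lambda>_. 1) \<and>
             (\<forall>\<^sub>F n in sequentially.
                real (m n (k n)) = real n powr ((1 + \<epsilon> n) * real (n choose k n)))"
proof -
  obtain \<delta> :: "nat \<Rightarrow> real" where "\<delta> \<in> o(\<lambda>_. 1)"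
    and k: "\<forall>\<^sub>F n in sequentially. real (k n) = real n powr \<delta> n"
    using assms by blast
  then have \<delta>: "\<delta> \<longlonglongrightarrow> 0" using smalloD_tendsto by fastforce
  \<comment> \<open>With this normalised logarithm the required error is \<open>R n - 1\<close>, so
    it remains to squeeze \<open>R\<close> to 1.\<close>
  define R where "R n = ln (real (m n (k n))) / (ln (real n) * real (n choose k n))" for n
  have ev: "\<forall>\<^sub>F n in sequentially. \<delta> n < 1/2 \<and> n \<ge> 5 \<and> ln (real n) \<ge> 1
      \<and> 2 * sqrt (real n) * ln (real n) \<le> real n \<and> sqrt (real n) \<le> real n
      \<and> real (k n) = real n powr \<delta> n"
  proof (intro eventually_conj k)
    show "\<forall>\<^sub>F n in sequentially. \<delta> n < 1/2" using order_tendstoD(2)[OF \<delta>, of "1/2"] by simp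
    show "\<forall>\<^sub>F n in sequentially. (5::nat) \<le> n" by (rule eventually_ge_at_top)
    show "\<forall>\<^sub>F n in sequentially. 1 \<le> ln (real n)" by real_asymp
    show "\<forall>\<^sub>F n in sequentially. 2 * sqrt (real n) * ln (real n) \<le> real n" by real_asymp
    show "\<forall>\<^sub>F n in sequentially. sqrt (real n) \<le> real n" by real_asymp
  qed
  let ?lo = "\<lambda>n. (1 - 1 / ln (real n)) * (1 - \<delta> n - ln (2 * ln (real n)) / ln (real n))"
  let ?up = "\<lambda>n. 2 * ln 2 / ln (real n)
      + (real n + 1) / (real n - 2 * sqrt (real n) + 1) * (1 + ln 4 / ln (real n))"
  have bounds: "\<forall>\<^sub>F n in sequentially. ?lo n \<le> R n \<and> R n \<le> ?up n \<and> m n (k n) > 0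
      \<and> n > 1 \<and> n choose k n > 0"
    using ev
  proof eventually_elim
    case (elim n)
    have n: "n \<ge> 5" and kn: "real (k n) = real n powr \<delta> n" using elim by auto
    \<comment> \<open>A power of a positive number is positive, so the growth hypothesis excludes
      \<open>k n = 0\<close>.\<close>
    then have "real (k n) > 0" by simp
    then have k1: "1 \<le> k n" by simp
    \<comment> \<open>An exponent below one half places \<open>k n\<close> below
      \<open>sqrt n\<close>, the range of both logarithmic bounds.\<close>
    have "real n powr \<delta> n \<le> real n powr (1/2)" using elim by (intro powr_mono) auto
    then have ks: "real (k n) \<le> sqrt (real n)" using kn n by (simp add: powr_half_sqrt)
    have "real (k n) \<le> real n" using ks elim by linarith
    then have kn': "k n \<le> n" by simp
    have "2 * real (k n) * ln (real n) \<le> 2 * sqrt (real n) * ln (real n)"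
      using ks elim by (intro mult_right_mono) auto
    then have c: "2 * real (k n) * ln (real n) \<le> real n" using elim by linarith
    have L: "ln (real n) \<ge> 1" using elim by simp
    have "ln (real (k n)) / ln (real n) = \<delta> n" using kn n L by (simp add: ln_powr)
    then have "?lo n \<le> R n" using ln_m_lower(1)[OF k1 kn' L c] by (simp add: R_def)
    moreover have m0: "m n (k n) > 0" using ln_m_lower(2)[OF k1 kn' L c] .
    moreover have "R n \<le> ?up n" using ln_m_upper[OF k1 ks n m0] by (simp add: R_def)
    ultimately show ?case using n kn' by simp
  qed
  have "(\<lambda>n. 1 - 1 / ln (real n)) \<longlonglongrightarrow> 1" by real_asymp
  moreover have "(\<lambda>n. ln (2 * ln (real n)) / ln (real n)) \<longlonglongrightarrow> 0" by real_asymp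
  ultimately have "?lo \<longlonglongrightarrow> 1 * (1 - 0 - 0)" using \<delta> by (intro tendsto_intros)
  moreover have "?up \<longlonglongrightarrow> 1" by real_asymp
  ultimately have R: "R \<longlonglongrightarrow> 1"
    using bounds by (intro tendsto_sandwich[of ?lo R _ ?up]) (auto elim: eventually_mono)
  show ?thesis
  proof (intro exI conjI)
    have "(\<lambda>n. R n - 1) \<longlonglongrightarrow> 0" using tendsto_diff[OF R tendsto_const[of 1]] by simp
    then show "(\<lambda>n. R n - 1) \<in> o(\<lambda>_. 1)" by (intro smalloI_tendsto) auto
    show "\<forall>\<^sub>F n in sequentially.
        real (m n (k n)) = real n powr ((1 + (R n - 1)) * real (n choose k n))"
      using bounds
    proof eventually_elim
      case (elim n)
      \<comment> \<open>The eventual facts \<open>n > 1\<close> and \<open>n choose k n > 0\<close>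
        make the denominator of \<open>R n\<close> nonzero; positivity of \<open>m n (k n)\<close>
        then allows exponentiating its logarithm.\<close>
      have "R n * real (n choose k n) * ln (real n) = ln (real (m n (k n)))"
        using elim by (simp add: R_def)
      then show ?case using elim by (simp add: powr_def)
    qed
  qed
qed

end
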